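(* Let $q\ge2$, $n\ge1$ be integers and $f,g:\mathbb{Z}_q^n\to\mathbb{Z}_{2q}$. Then $\mathcal{C}^q_f(\mathbf{u})+\mathcal{C}^q_g(\mathbf{u})=0$ for all $\mathbf{u}\in\mathbb{Z}_q^n\setminus\{\mathbf{0}\}$ if and only if $$|\mathcal{N}_f(\mathbf{u})|^2+|\mathcal{N}_g(\mathbf{u})|^2=2\quad\text{for all }\mathbf{u}\in\mathbb{Z}_q^n.$$
   Context: $\mathbb{Z}_m$ is the ring of integers modulo $m$. For $x\in\mathbb{Z}_q$, $\hat{x}\in\{0,\ldots,q-1\}$ is its least non-negative integer representative, and $\hat{\mathbf{x}}=(\hat{x}_1,\ldots,\hat{x}_n)$. Let $\xi$ be a primitive $q$-th root of unity and $\omega$ a primitive $2q$-th root of unity; $\langle\hat{\mathbf{x}},\hat{\mathbf{u}}\rangle=\sum_i\hat x_i\hat u_i$. The $2q$-nega-Hadamard transform of $f:\mathbb{Z}_q^n\to\mathbb{Z}_{2q}$ is $\mathcal{N}_f(\mathbf{u})=q^{-n/2}\sum_{\mathbf{x}\in\mathbb{Z}_q^n}\omega^{f(\mathbf{x})}\xi^{\langle\hat{\mathbf{x}},\hat{\mathbf{u}}\rangle}\omega^{\sum_i\hat{x}_i}$. With $n_q(\hat{\mathbf{x}},\hat{\mathbf{u}})=|\{i:\hat{x}_i+\hat{u}_i\ge q\}|$, the $2q$-nega-autocorrelation of $f$ at $\mathbf{u}$ is $\mathcal{C}^q_f(\mathbf{u})=\sum_{\mathbf{x}\in\mathbb{Z}_q^n}\omega^{f(\mathbf{x})-f(\mathbf{x}+\mathbf{u})}(-1)^{n_q(\hat{\mathbf{x}},\hat{\mathbf{u}})}$.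 *)

theory Defs
  imports "HOL-Analysis.Analysis" "HOL-Number_Theory.Residues"
begin

text \<open>
  The ring of integers modulo \<open>m\<close> is \<open>residue_ring (int m)\<close>, whose carrier is the set of
  integers \<open>{0..int m - 1}\<close>. Its elements therefore are their own least non-negative
  representatives: wherever a residue is used below as an integer (in exponents, in inner
  products, in comparisons with \<open>q\<close>), it is this representative that is meant.
\<close>

definition Zvec :: "nat \<Rightarrow> nat \<Rightarrow> (nat \<Rightarrow> int) set" where
  "Zvec q n = (\<Pi>\<^sub>E i\<in>{..<n}. carrier (residue_ring (int q)))"

definition Zvec_zero :: "nat \<Rightarrow> nat \<Rightarrow> nat \<Rightarrow> int" where
  "Zvec_zero q n = (\<lambda>i\<in>{..<n}. \<zero>\<^bsub>residue_ring (int q)\<^esub>)"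

definition Zvec_add :: "nat \<Rightarrow> nat \<Rightarrow> (nat \<Rightarrow> int) \<Rightarrow> (nat \<Rightarrow> int) \<Rightarrow> nat \<Rightarrow> int" where
  "Zvec_add q n x u = (\<lambda>i\<in>{..<n}. x i \<oplus>\<^bsub>residue_ring (int q)\<^esub> u i)"

definition primitive_root_of_unity :: "nat \<Rightarrow> complex \<Rightarrow> bool" where
  "primitive_root_of_unity m z \<longleftrightarrow> m > 0 \<and> z ^ m = 1 \<and> (\<forall>k. 0 < k \<and> k < m \<longrightarrow> z ^ k \<noteq> 1)"

definition nega_Hadamard ::
  "nat \<Rightarrow> nat \<Rightarrow> complex \<Rightarrow> complex \<Rightarrow> ((nat \<Rightarrow> int) \<Rightarrow> int) \<Rightarrow> (nat \<Rightarrow> int) \<Rightarrow> complex" where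
  "nega_Hadamard q n \<xi> \<omega> f u =
     complex_of_real (real q powr (- (real n / 2))) *
     (\<Sum>x\<in>Zvec q n. \<omega> powi f x * \<xi> powi (\<Sum>i<n. x i * u i) * \<omega> powi (\<Sum>i<n. x i))"

definition carry_count :: "nat \<Rightarrow> nat \<Rightarrow> (nat \<Rightarrow> int) \<Rightarrow> (nat \<Rightarrow> int) \<Rightarrow> nat" where
  "carry_count q n x u = card {i\<in>{..<n}. x i + u i \<ge> int q}"

definition nega_autocorrelation ::
  "nat \<Rightarrow> nat \<Rightarrow> complex \<Rightarrow> ((nat \<Rightarrow> int) \<Rightarrow> int) \<Rightarrow> (nat \<Rightarrow> int) \<Rightarrow> complex" where
  "nega_autocorrelation q n \<omega> f u =
     (\<Sum>x\<in>Zvec q n.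
        \<omega> powi (f x \<ominus>\<^bsub>residue_ring (2 * int q)\<^esub> f (Zvec_add q n x u)) * (-1) ^ carry_count q n x u)"

end

theory Submission
  imports Defs
begin

text \<open>
  A Wiener--Khinchin argument. Substituting \<open>y = x + v\<close> in the double sum for
  \<open>\<bar>N\<^sub>f(u)\<bar>\<^sup>2\<close>, each carry of \<open>x + v\<close> contributes \<open>\<omega>\<^sup>q = -1\<close>, so that
  \<open>q\<^sup>n \<bar>N\<^sub>f(u)\<bar>\<^sup>2\<close> is the discrete Fourier transform of
  \<open>v \<mapsto> C\<^sub>f(v) \<omega>\<^bsup>-\<Sigma>v\<^esup>\<close>. Adding the transform for
  \<open>g\<close> and using \<open>C\<^sub>f(0) = C\<^sub>g(0) = q\<^sup>n\<close>, the claim says that a function is supported at \<open>0\<close>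
  iff its transform is constant, which is Fourier inversion.
\<close>

section \<open>Vectors of least residues, their addition and its carries\<close>

lemma Zvec_eq: "Zvec q n = (\<Pi>\<^sub>E i\<in>{..<n}. {0..<int q})"
  by (auto simp: Zvec_def residue_ring_def PiE_def Pi_def)

lemma finite_Zvec: "finite (Zvec q n)"
  by (simp add: Zvec_eq finite_PiE)

lemma card_Zvec: "card (Zvec q n) = q ^ n"
  by (simp add: Zvec_eq card_PiE)

lemma Zvec_zero_eq: "Zvec_zero q n = (\<lambda>i\<in>{..<n}. 0)"
  by (simp add: Zvec_zero_def residue_ring_def)

lemma Zvec_add_eq: "Zvec_add q n x u = (\<lambda>i\<in>{..<n}. (x i + u i) mod int q)"
  by (simp add: Zvec_add_def residue_ring_def)

lemma Zvec_memD:
  assumes "x \<in> Zvec q n" "i < n"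
  shows "0 \<le> x i" "x i < int q"
  using assms by (auto simp: Zvec_eq PiE_def Pi_def)

lemma Zvec_zero_mem: "q > 0 \<Longrightarrow> Zvec_zero q n \<in> Zvec q n"
  by (auto simp: Zvec_zero_eq Zvec_eq)

lemma Zvec_add_mem: "q > 0 \<Longrightarrow> Zvec_add q n x u \<in> Zvec q n"
  by (auto simp: Zvec_add_eq Zvec_eq)

lemma Zvec_eqI:
  assumes "x \<in> Zvec q n" "y \<in> Zvec q n" "\<And>i. i < n \<Longrightarrow> x i = y i"
  shows "x = y"
  using assms unfolding Zvec_eq by (intro PiE_ext) auto

lemma Zvec_add_zero:
  assumes "x \<in> Zvec q n"
  shows "Zvec_add q n x (Zvec_zero q n) = x"
proof -
  \<comment> \<open>For \<open>n > 0\<close> the coordinate \<open>x 0\<close> lies in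
    \<open>{0..<int q}\<close>, which forces \<open>q > 0\<close>; for \<open>n = 0\<close> the only
    vector is undefined everywhere.\<close>
  have "q > 0 \<or> n = 0"
    using Zvec_memD[OF assms, of 0] by (cases n) auto
  then have "Zvec_add q n x (Zvec_zero q n) \<in> Zvec q n"
    by (auto simp: Zvec_add_mem Zvec_add_eq Zvec_eq)
  then show ?thesis
    using assms by (rule Zvec_eqI) (use Zvec_memD[OF assms] in \<open>simp add: Zvec_add_eq Zvec_zero_eq\<close>)
qed

text \<open>Cancelling \<open>x i\<close> modulo \<open>q\<close> gives injectivity, and an
  injective self-map of a finite set is onto. This permits the substitution of \<open>x + v\<close>
  for \<open>y\<close> with \<open>x\<close> fixed.\<close>

lemma bij_betw_Zvec_add:
  assumes "q > 0"
  shows "bij_betw (Zvec_add q n x) (Zvec q n) (Zvec q n)"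
proof -
  have inj: "inj_on (Zvec_add q n x) (Zvec q n)"
  proof (rule inj_onI)
    fix u v assume u: "u \<in> Zvec q n" and v: "v \<in> Zvec q n"
      and eq: "Zvec_add q n x u = Zvec_add q n x v"
    show "u = v"
    proof (rule Zvec_eqI[OF u v])
      fix i assume i: "i < n"
      have "(x i + u i) mod int q = (x i + v i) mod int q"
        using fun_cong[OF eq, of i] i by (simp add: Zvec_add_eq)
      then have "[u i = v i] (mod int q)"
        by (simp add: cong_add_lcancel flip: cong_def)
      then show "u i = v i"
        using Zvec_memD[OF u i] Zvec_memD[OF v i] by (simp add: cong_def)
    qed
  qed
  have "Zvec_add q n x ` Zvec q n = Zvec q n"
    by (rule endo_inj_surj[OF finite_Zvec _ inj]) (auto intro: Zvec_add_mem assms)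
  with inj show ?thesis by (simp add: bij_betw_def)
qed

text \<open>Each coordinate sum is below \<open>2 * q\<close>, so reduction subtracts
  \<open>q\<close> once at a carry and nothing elsewhere. An exact equation is needed because this
  sum is an exponent of \<open>\<omega>\<close>, whose order is \<open>2 * q\<close>.\<close>

lemma sum_Zvec_add:
  assumes "x \<in> Zvec q n" "v \<in> Zvec q n"
  shows "(\<Sum>i<n. Zvec_add q n x v i)
       = (\<Sum>i<n. x i) + (\<Sum>i<n. v i) - int q * int (carry_count q n x v)"
proof -
  have "(x i + v i) mod int q = x i + v i - int q * (if int q \<le> x i + v i then 1 else 0)"
    if "i < n" for i
  proof (cases "int q \<le> x i + v i")
    case True
    have "(x i + v i) mod int q = (x i + v i - int q) mod int q"
      by simp
    also have "\<dots> = x i + v i - int q"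
      using True Zvec_memD[OF assms(1) that] Zvec_memD[OF assms(2) that]
      by (intro mod_pos_pos_trivial) auto
    finally show ?thesis using True by simp
  qed (use Zvec_memD[OF assms(1) that] Zvec_memD[OF assms(2) that] in simp)
  moreover have "(\<Sum>i<n. if int q \<le> x i + v i then 1 else 0) = int (carry_count q n x v)"
    by (simp add: carry_count_def sum.If_cases Int_def)
  ultimately show ?thesis
    by (simp add: Zvec_add_eq sum.distrib sum_subtractf flip: sum_distrib_left)
qed

text \<open>Inner products are exponents of \<open>\<xi>\<close> only, so a congruence modulo
  \<open>q\<close> suffices and carries leave no trace.\<close>

lemma inner_Zvec_add_cong:
  "[(\<Sum>i<n. x i * u i) - (\<Sum>i<n. Zvec_add q n x v i * u i) = - (\<Sum>i<n. v i * u i)] (mod int q)"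
proof -
  have "[(\<Sum>i<n. Zvec_add q n x v i * u i) = (\<Sum>i<n. (x i + v i) * u i)] (mod int q)"
    by (intro cong_sum cong_scalar_right) (simp add: Zvec_add_eq cong_def)
  then have "[(\<Sum>i<n. x i * u i) - (\<Sum>i<n. Zvec_add q n x v i * u i)
            = (\<Sum>i<n. x i * u i) - (\<Sum>i<n. (x i + v i) * u i)] (mod int q)"
    by (intro cong_diff cong_refl)
  then show ?thesis
    by (simp add: algebra_simps sum.distrib)
qed

section \<open>Integer powers of roots of unity\<close>

lemma powi_sum:
  fixes z :: complex
  assumes "z \<noteq> 0"
  shows "z powi (\<Sum>i\<in>A. h i) = (\<Prod>i\<in>A. z powi h i)"
  by (induction A rule: infinite_finite_induct) (simp_all add: power_int_add assms)

lemma norm_root_of_unity: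
  assumes "primitive_root_of_unity m z"
  shows "norm z = 1"
  using assms power_eq_1_iff[of z m] by (auto simp: primitive_root_of_unity_def)

lemma primitive_root_nonzero:
  assumes "primitive_root_of_unity m z"
  shows "z \<noteq> 0"
  using norm_root_of_unity[OF assms] by auto

text \<open>On the unit circle conjugation is inversion.\<close>

lemma cnj_powi_root_of_unity:
  assumes "primitive_root_of_unity m z"
  shows "cnj (z powi k) = z powi (- k)"
proof -
  have "z * cnj z = 1"
    using complex_norm_square[of z] norm_root_of_unity[OF assms] by simp
  then have "cnj z = inverse z"
    by (metis inverse_unique)
  then show ?thesis
    by (simp add: power_int_minus power_int_inverse)
qed

lemma powi_eq_1_iff_dvd:
  assumes "primitive_root_of_unity m z"
  shows "z powi k = 1 \<longleftrightarrow> int m dvd k"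
proof -
  have m: "m > 0" and z: "z ^ m = 1" "z \<noteq> 0"
    using assms primitive_root_nonzero by (auto simp: primitive_root_of_unity_def)
  \<comment> \<open>Primitivity speaks of natural exponents below \<open>m\<close>, so
    \<open>k\<close> is replaced by its remainder.\<close>
  define r where "r = nat (k mod int m)"
  have r: "int r = k mod int m" "r < m"
    using m by (simp_all add: r_def nat_less_iff)
  have "z powi k = z powi (int m * (k div int m) + int r)"
    by (simp add: r)
  also have "\<dots> = (z powi int m) powi (k div int m) * z ^ r"
    using z by (simp add: power_int_add power_int_mult)
  also have "\<dots> = z ^ r"
    using z by simp
  finally have "z powi k = z ^ r" .
  moreover have "z ^ r = 1 \<longleftrightarrow> r = 0"
    using assms r(2) by (auto simp: primitive_root_of_unity_def)
  ultimately show ?thesis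
    using r(1) by (auto simp: dvd_eq_mod_eq_0)
qed

lemma powi_cong:
  assumes "primitive_root_of_unity m z" "[a = b] (mod int m)"
  shows "z powi a = z powi b"
proof -
  have "z powi (a - b) = 1"
    using assms by (simp add: powi_eq_1_iff_dvd cong_iff_dvd_diff)
  then show ?thesis
    using primitive_root_nonzero[OF assms(1)] by (simp add: power_int_diff)
qed

text \<open>The square of \<open>z ^ q\<close> is 1, and primitivity excludes the value 1 itself.
  This is the sign that a carry produces.\<close>

lemma primitive_root_half_power:
  assumes "primitive_root_of_unity (2 * q) z"
  shows "z ^ q = -1"
proof -
  have "q > 0" "(z ^ q)\<^sup>2 = 1" and "z ^ q \<noteq> 1"
    using assms by (auto simp: primitive_root_of_unity_def simp flip: power_mult power_even_eq)
      (simp add: mult.commute)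
  then show ?thesis by (simp add: power2_eq_1_iff)
qed

text \<open>A geometric sum whose ratio \<open>z powi k\<close> differs from 1 but has
  \<open>m\<close>-th power 1.\<close>

lemma sum_powi_root_of_unity:
  assumes "primitive_root_of_unity m z" "\<not> int m dvd k"
  shows "(\<Sum>a\<in>{0..<int m}. z powi (a * k)) = 0"
proof -
  have "(\<Sum>a\<in>{0..<int m}. z powi (a * k)) = (\<Sum>a<m. (z powi k) ^ a)"
    by (rule sum.reindex_bij_witness[of _ int nat])
      (auto simp: mult.commute[of _ k] power_int_mult nat_less_iff simp flip: power_int_of_nat)
  moreover have "z powi k \<noteq> 1"
    using assms by (simp add: powi_eq_1_iff_dvd)
  moreover have "(z powi k) ^ m = 1"
    using assms(1) by (simp add: powi_eq_1_iff_dvd flip: power_int_of_nat power_int_mult)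
  ultimately show ?thesis
    by (simp add: geometric_sum)
qed

section \<open>Orthogonality of characters and Fourier inversion\<close>

lemma character_orthogonality:
  assumes "primitive_root_of_unity q \<xi>" "i < n" "\<not> int q dvd w i"
  shows "(\<Sum>u\<in>Zvec q n. \<xi> powi (\<Sum>i<n. u i * w i)) = 0"
proof -
  have "(\<Sum>u\<in>Zvec q n. \<xi> powi (\<Sum>i<n. u i * w i))
      = (\<Sum>u\<in>Zvec q n. \<Prod>i<n. \<xi> powi (u i * w i))"
    by (simp add: powi_sum primitive_root_nonzero[OF assms(1)])
  \<comment> \<open>The sum over vectors factors by coordinate; the factor at the given
    \<open>i\<close> vanishes.\<close>
  also have "\<dots> = (\<Prod>i<n. \<Sum>a\<in>{0..<int q}. \<xi> powi (a * w i))"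
    unfolding Zvec_eq by (rule prod_sum_PiE[symmetric]) auto
  also have "\<dots> = 0"
    using assms sum_powi_root_of_unity[OF assms(1,3)] by (intro prod_zero) auto
  finally show ?thesis .
qed

text \<open>Distinct vectors differ in some coordinate by less than \<open>q\<close> in absolute
  value, hence by a non-multiple of \<open>q\<close>.\<close>

lemma character_orthogonality_diff:
  assumes "primitive_root_of_unity q \<xi>" "v \<in> Zvec q n" "w \<in> Zvec q n"
  shows "(\<Sum>u\<in>Zvec q n. \<xi> powi (\<Sum>i<n. u i * (w i - v i))) = (if v = w then of_nat (q ^ n) else 0)"
proof (cases "v = w")
  case False
  then obtain i where i: "i < n" "v i \<noteq> w i"
    using Zvec_eqI[OF assms(2,3)] by blast
  have "\<not> int q dvd w i - v i"
    using i Zvec_memD[OF assms(2) i(1)] Zvec_memD[OF assms(3) i(1)]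
    by (auto simp flip: mod_eq_dvd_iff)
  from character_orthogonality[where w = "\<lambda>i. w i - v i", OF assms(1) i(1) this] False show ?thesis by simp
qed (simp add: card_Zvec)

text \<open>Summing the transform against the character of \<open>w\<close> isolates
  \<open>q ^ n\<close> times \<open>D w\<close>. When the transform is constant, the same sum is
  \<open>c\<close> times the full sum of a nontrivial character, which is 0.\<close>

lemma Fourier_constant_imp_supported_at_zero:
  assumes "primitive_root_of_unity q \<xi>"
    and "\<And>u. u \<in> Zvec q n \<Longrightarrow> (\<Sum>v\<in>Zvec q n. D v * \<xi> powi (- (\<Sum>i<n. v i * u i))) = c"
    and "w \<in> Zvec q n" "w \<noteq> Zvec_zero q n"
  shows "D w = 0"
proof -
  have q: "q > 0" using assms(1) by (simp add: primitive_root_of_unity_def)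
  note nz = primitive_root_nonzero[OF assms(1)]
  have "of_nat (q ^ n) * D w = (\<Sum>v\<in>Zvec q n. if v = w then D v * of_nat (q ^ n) else 0)"
    using assms(3) by (simp add: finite_Zvec mult.commute)
  also have "\<dots> = (\<Sum>v\<in>Zvec q n. D v * (\<Sum>u\<in>Zvec q n. \<xi> powi (\<Sum>i<n. u i * (w i - v i))))"
    using assms(1,3) by (intro sum.cong) (auto simp: character_orthogonality_diff)
  also have "\<dots> = (\<Sum>u\<in>Zvec q n. \<Sum>v\<in>Zvec q n. D v * \<xi> powi (\<Sum>i<n. u i * (w i - v i)))"
    unfolding sum_distrib_left by (rule sum.swap)
  also have "\<dots> = (\<Sum>u\<in>Zvec q n. \<xi> powi (\<Sum>i<n. u i * w i) *
                   (\<Sum>v\<in>Zvec q n. D v * \<xi> powi (- (\<Sum>i<n. v i * u i))))"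
    unfolding sum_distrib_left
    by (intro sum.cong refl)
      (simp add: right_diff_distrib sum_subtractf power_int_diff power_int_minus_left nz field_simps power_int_minus)
  also have "\<dots> = (\<Sum>u\<in>Zvec q n. \<xi> powi (\<Sum>i<n. u i * w i)) * c"
    by (simp add: assms(2) sum_distrib_right)
  also have "\<dots> = 0"
  proof -
    \<comment> \<open>Reading \<open>w\<close> as its difference from the zero vector brings the sum
      into the form of the orthogonality relation.\<close>
    have "(\<Sum>u\<in>Zvec q n. \<xi> powi (\<Sum>i<n. u i * (w i - Zvec_zero q n i))) = 0"
      using character_orthogonality_diff[OF assms(1) Zvec_zero_mem[OF q] assms(3)] assms(4) by auto
    then show ?thesis by (simp add: Zvec_zero_eq)
  qed
  finally show ?thesis using q by simp
qed

section \<open>The squared transform as a Fourier transform of the autocorrelation\<close>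

lemma residue_ring_minus_cong:
  assumes "m > 1"
  shows "[a \<ominus>\<^bsub>residue_ring m\<^esub> b = a - b] (mod m)"
proof -
  interpret residues m "residue_ring m" by unfold_locales (simp_all add: assms)
  show ?thesis
    by (simp add: a_minus_def res_neg_eq res_add_eq cong_def mod_simps)
qed

text \<open>The three pairs of factors are treated separately: values of \<open>f\<close>,
  characters of \<open>\<xi>\<close>, and coordinate sums. The last pair yields both the carry sign
  and the twist by a power of \<open>\<omega>\<close> depending on \<open>v\<close> alone.\<close>

lemma nega_Hadamard_term_product:
  assumes "q > 0" "primitive_root_of_unity q \<xi>" "primitive_root_of_unity (2 * q) \<omega>"
    and "x \<in> Zvec q n" "v \<in> Zvec q n"
  defines "y \<equiv> Zvec_add q n x v"
  shows "(\<omega> powi f x * \<xi> powi (\<Sum>i<n. x i * u i) * \<omega> powi (\<Sum>i<n. x i)) *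
         cnj (\<omega> powi f y * \<xi> powi (\<Sum>i<n. y i * u i) * \<omega> powi (\<Sum>i<n. y i))
       = (\<omega> powi (f x \<ominus>\<^bsub>residue_ring (2 * int q)\<^esub> f y) * (-1) ^ carry_count q n x v) *
         (\<omega> powi (- (\<Sum>i<n. v i)) * \<xi> powi (- (\<Sum>i<n. v i * u i)))"
proof -
  note nz = primitive_root_nonzero[OF assms(2)] primitive_root_nonzero[OF assms(3)]
  note cnj = cnj_powi_root_of_unity[OF assms(2)] cnj_powi_root_of_unity[OF assms(3)]
  have 1: "\<omega> powi f x * cnj (\<omega> powi f y) = \<omega> powi (f x \<ominus>\<^bsub>residue_ring (2 * int q)\<^esub> f y)"
  proof -
    have "\<omega> powi (f x \<ominus>\<^bsub>residue_ring (2 * int q)\<^esub> f y) = \<omega> powi (f x - f y)"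
      using residue_ring_minus_cong[of "2 * int q" "f x" "f y"] assms(1)
      by (intro powi_cong[OF assms(3)]) auto
    then show ?thesis unfolding cnj by (simp add: nz flip: power_int_add)
  qed
  have 2: "\<xi> powi (\<Sum>i<n. x i * u i) * cnj (\<xi> powi (\<Sum>i<n. y i * u i))
         = \<xi> powi (- (\<Sum>i<n. v i * u i))"
    using powi_cong[OF assms(2) inner_Zvec_add_cong[of x u n q v]]
    unfolding cnj by (simp add: nz y_def flip: power_int_add)
  have 3: "\<omega> powi (\<Sum>i<n. x i) * cnj (\<omega> powi (\<Sum>i<n. y i))
         = (-1) ^ carry_count q n x v * \<omega> powi (- (\<Sum>i<n. v i))"
  proof -
    have "\<omega> powi (\<Sum>i<n. x i) * cnj (\<omega> powi (\<Sum>i<n. y i))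
        = \<omega> powi (int q * int (carry_count q n x v) + - (\<Sum>i<n. v i))"
      unfolding cnj by (simp add: nz y_def sum_Zvec_add[OF assms(4,5)] flip: power_int_add)
    also have "\<dots> = (\<omega> ^ q) ^ carry_count q n x v * \<omega> powi (- (\<Sum>i<n. v i))"
      by (simp only: power_int_add nz power_int_mult power_int_of_nat simp_thms)
    finally show ?thesis by (simp add: primitive_root_half_power[OF assms(3)])
  qed
  show ?thesis
    unfolding complex_cnj_mult 1[symmetric] 2[symmetric]
    using 3 by (simp add: algebra_simps)
qed

lemma norm_nega_Hadamard_squared:
  assumes "q > 0" "primitive_root_of_unity q \<xi>" "primitive_root_of_unity (2 * q) \<omega>"
  shows "of_nat (q ^ n) * complex_of_real ((cmod (nega_Hadamard q n \<xi> \<omega> f u))\<^sup>2)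
       = (\<Sum>v\<in>Zvec q n. nega_autocorrelation q n \<omega> f v * \<omega> powi (- (\<Sum>i<n. v i))
            * \<xi> powi (- (\<Sum>i<n. v i * u i)))"
proof -
  define G where "G x = \<omega> powi f x * \<xi> powi (\<Sum>i<n. x i * u i) * \<omega> powi (\<Sum>i<n. x i)" for x
  define s where "s = real q powr (- (real n / 2))"
  \<comment> \<open>The factor \<open>q ^ n\<close> in the statement exactly cancels the squared
    normalization.\<close>
  have s: "real (q ^ n) * s\<^sup>2 = 1"
  proof -
    have "s\<^sup>2 = real q powr (- real n)"
      unfolding s_def power2_eq_square by (simp flip: powr_add)
    also have "\<dots> = inverse (real q ^ n)"
      using assms(1) by (simp add: powr_minus powr_realpow)
    finally show ?thesis using assms(1) by simp
  qed
  have N: "nega_Hadamard q n \<xi> \<omega> f u = complex_of_real s * (\<Sum>x\<in>Zvec q n. G x)"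
    by (simp add: nega_Hadamard_def s_def G_def)
  have "of_nat (q ^ n) * complex_of_real ((cmod (nega_Hadamard q n \<xi> \<omega> f u))\<^sup>2)
      = complex_of_real (real (q ^ n) * s\<^sup>2) * ((\<Sum>x\<in>Zvec q n. G x) * cnj (\<Sum>x\<in>Zvec q n. G x))"
    unfolding complex_norm_square N by (simp add: power2_eq_square)
  also have "\<dots> = (\<Sum>x\<in>Zvec q n. \<Sum>y\<in>Zvec q n. G x * cnj (G y))"
    unfolding s by (simp add: sum_product)
  also have "\<dots> = (\<Sum>x\<in>Zvec q n. \<Sum>v\<in>Zvec q n. G x * cnj (G (Zvec_add q n x v)))"
    by (intro sum.cong refl sum.reindex_bij_betw[symmetric] bij_betw_Zvec_add assms(1))
  \<comment> \<open>With \<open>v\<close> outermost, the inner sum over \<open>x\<close> is the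
    autocorrelation at \<open>v\<close> times a factor free of \<open>x\<close>.\<close>
  also have "\<dots> = (\<Sum>v\<in>Zvec q n. \<Sum>x\<in>Zvec q n. G x * cnj (G (Zvec_add q n x v)))"
    by (rule sum.swap)
  also have "\<dots> = (\<Sum>v\<in>Zvec q n. nega_autocorrelation q n \<omega> f v *
                   (\<omega> powi (- (\<Sum>i<n. v i)) * \<xi> powi (- (\<Sum>i<n. v i * u i))))"
    unfolding nega_autocorrelation_def sum_distrib_right G_def
    by (intro sum.cong refl nega_Hadamard_term_product assms)
  finally show ?thesis by (simp only: mult.assoc)
qed

text \<open>Adding zero causes no carry and leaves \<open>x\<close> fixed, so each of the
  \<open>q ^ n\<close> summands is 1.\<close>

lemma nega_autocorrelation_zero:
  assumes "q > 0" "primitive_root_of_unity (2 * q) \<omega>"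
  shows "nega_autocorrelation q n \<omega> f (Zvec_zero q n) = of_nat (q ^ n)"
proof -
  have "\<omega> powi (f x \<ominus>\<^bsub>residue_ring (2 * int q)\<^esub> f (Zvec_add q n x (Zvec_zero q n))) *
      (-1) ^ carry_count q n x (Zvec_zero q n) = 1" if x: "x \<in> Zvec q n" for x
  proof -
    have "carry_count q n x (Zvec_zero q n) = 0"
      using Zvec_memD(2)[OF x] by (auto simp: carry_count_def Zvec_zero_eq not_le)
    moreover have "\<omega> powi (f x \<ominus>\<^bsub>residue_ring (2 * int q)\<^esub> f x) = \<omega> powi 0"
      using residue_ring_minus_cong[of "2 * int q" "f x" "f x"] assms(1)
      by (intro powi_cong[OF assms(2)]) auto
    ultimately show ?thesis by (simp add: Zvec_add_zero[OF x])
  qed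
  then show ?thesis by (simp add: nega_autocorrelation_def card_Zvec)
qed

theorem theorem5:
  fixes q n :: nat and \<xi> \<omega> :: complex and f g :: "(nat \<Rightarrow> int) \<Rightarrow> int"
  assumes "q \<ge> 2" and "n \<ge> 1"
    and "primitive_root_of_unity q \<xi>" and "primitive_root_of_unity (2 * q) \<omega>"
    and "f \<in> Zvec q n \<rightarrow> carrier (residue_ring (2 * int q))"
    and "g \<in> Zvec q n \<rightarrow> carrier (residue_ring (2 * int q))"
  shows "(\<forall>u \<in> Zvec q n - {Zvec_zero q n}.
            nega_autocorrelation q n \<omega> f u + nega_autocorrelation q n \<omega> g u = 0) \<longleftrightarrow>
         (\<forall>u \<in> Zvec q n.
            (cmod (nega_Hadamard q n \<xi> \<omega> f u))\<^sup>2 + (cmod (nega_Hadamard q n \<xi> \<omega> g u))\<^sup>2 = 2)"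
proof -
  have q: "q > 0" using assms(1) by simp
  note \<xi> = assms(3) and \<omega> = assms(4)
  define C where "C v = nega_autocorrelation q n \<omega> f v + nega_autocorrelation q n \<omega> g v" for v
  \<comment> \<open>The twist is a nonzero factor, so \<open>D\<close> and \<open>C\<close> have the
    same zeros.\<close>
  define D where "D v = C v * \<omega> powi (- (\<Sum>i<n. v i))" for v
  define S where
    "S u = (cmod (nega_Hadamard q n \<xi> \<omega> f u))\<^sup>2 + (cmod (nega_Hadamard q n \<xi> \<omega> g u))\<^sup>2" for u
  have transform: "of_nat (q ^ n) * complex_of_real (S u)
      = (\<Sum>v\<in>Zvec q n. D v * \<xi> powi (- (\<Sum>i<n. v i * u i)))" for u
    unfolding S_def D_def C_def of_real_add distrib_left distrib_right sum.distrib
    by (simp only: norm_nega_Hadamard_squared[OF q \<xi> \<omega>])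
  have "(\<forall>v \<in> Zvec q n - {Zvec_zero q n}. C v = 0) \<longleftrightarrow> (\<forall>u \<in> Zvec q n. S u = 2)"
  proof (intro iffI ballI)
    fix u assume C: "\<forall>v \<in> Zvec q n - {Zvec_zero q n}. C v = 0"
    \<comment> \<open>Only the term at the zero vector survives in the transform.\<close>
    have "of_nat (q ^ n) * complex_of_real (S u)
        = D (Zvec_zero q n) * \<xi> powi (- (\<Sum>i<n. Zvec_zero q n i * u i))"
      unfolding transform sum.remove[OF finite_Zvec Zvec_zero_mem[OF q]]
      using C by (simp add: D_def)
    also have "\<dots> = of_nat (q ^ n) * 2"
    proof -
      have "(\<Sum>i<n. Zvec_zero q n i * k i) = 0" "(\<Sum>i<n. Zvec_zero q n i) = 0" for k
        by (simp_all add: Zvec_zero_eq)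
      then show ?thesis
        by (simp add: D_def C_def nega_autocorrelation_zero[OF q \<omega>])
    qed
    finally have "complex_of_real (S u) = 2"
      using q by simp
    then show "S u = 2"
      by (metis of_real_eq_iff of_real_numeral)
  next
    fix w assume S: "\<forall>u \<in> Zvec q n. S u = 2" and w: "w \<in> Zvec q n - {Zvec_zero q n}"
    have "D w = 0"
    proof (rule Fourier_constant_imp_supported_at_zero[OF \<xi>])
      \<comment> \<open>The constant is \<open>q ^ n\<close> times the assumed value 2 of
        \<open>S\<close>.\<close>
      show "(\<Sum>v\<in>Zvec q n. D v * \<xi> powi (- (\<Sum>i<n. v i * u i))) = of_nat (q ^ n) * 2"
        if "u \<in> Zvec q n" for u
        using S that by (simp flip: transform)
    qed (use w in auto)
    then show "C w = 0"
      using primitive_root_nonzero[OF \<omega>] by (simp add: D_def)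
  qed
  then show ?thesis by (simp only: C_def S_def)
qed

end
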